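(* For every positive integer $n$, $$\alpha(4,n)=\binom{2\lceil n/2\rceil}{\lceil n/2\rceil}\sum_{i=0}^{\lceil n/2\rceil}\binom{\lceil n/2\rceil}{i}^2\binom{2i}{i}.$$
   Context: For positive integers $m,n$, let $A(m,n)$ be the set of all $m\times n$ matrices with every entry in $\{1,-1\}$ such that every row sum and every column sum has absolute value at most $1$, and let $\alpha(m,n)=|A(m,n)|$. *)

theory Defs
  imports "Jordan_Normal_Form.Matrix"
begin

definition balanced_mats :: "nat \<Rightarrow> nat \<Rightarrow> int mat set" where
  "balanced_mats m n =
     {M \<in> carrier_mat m n.
        (\<forall>i<m. \<forall>j<n. M $$ (i, j) \<in> {1, -1}) \<and>
        (\<forall>i<m. \<bar>\<Sum>j<n. M $$ (i, j)\<bar> \<le> 1) \<and>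
        (\<forall>j<n. \<bar>\<Sum>i<m. M $$ (i, j)\<bar> \<le> 1)}"

definition alpha :: "nat \<Rightarrow> nat \<Rightarrow> nat" where
  "alpha m n = card (balanced_mats m n)"

end

theory Submission
  imports Defs "HOL-Combinatorics.Multiset_Permutations"
begin

text \<open>
  Every column of a matrix in \<open>A(4, n)\<close> has two entries \<open>1\<close> and two entries \<open>-1\<close>, hence is one of
  \<open>\<plusminus>a\<close>, \<open>\<plusminus>b\<close>, \<open>\<plusminus>c\<close> with \<open>a\<close>, \<open>b\<close>, \<open>c\<close> linearly independent. So for \<open>n = 2k\<close>, where
  all row sums vanish, such matrices are the closed walks of length \<open>2k\<close> in the cubic lattice, and
  they are counted by the multinomial coefficients \<open>(2k)! / (p! q! r!)\<^sup>2\<close> with \<open>p + q + r = k\<close>.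
  For odd \<open>n\<close> exactly one column completes the matrix to one of width \<open>n + 1\<close> with zero row sums.
\<close>

section \<open>Admissible columns and row sums\<close>

datatype step = PX | NX | PY | NY | PZ | NZ

text \<open>The three \<open>P\<close> columns are those with top entry 1; they are pairwise
  orthogonal, and each \<open>N\<close> column is the negative of its partner.\<close>

definition column :: "step \<Rightarrow> int vec" where
  "column s = vec_of_list (case s of
     PX \<Rightarrow> [1, 1, -1, -1] | NX \<Rightarrow> [-1, -1, 1, 1] |
     PY \<Rightarrow> [1, -1, 1, -1] | NY \<Rightarrow> [-1, 1, -1, 1] |
     PZ \<Rightarrow> [1, -1, -1, 1] | NZ \<Rightarrow> [-1, 1, 1, -1])"

definition row_sum :: "nat \<Rightarrow> step list \<Rightarrow> int" where
  "row_sum i xs = (\<Sum>s\<leftarrow>xs. column s $ i)"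

definition closed_walk :: "step list \<Rightarrow> bool" where
  "closed_walk xs \<longleftrightarrow> count_list xs PX = count_list xs NX \<and>
     count_list xs PY = count_list xs NY \<and> count_list xs PZ = count_list xs NZ"

lemma UNIV_step: "UNIV = {PX, NX, PY, NY, PZ, NZ}"
proof (rule UNIV_eq_I)
  show "s \<in> {PX, NX, PY, NY, PZ, NZ}" for s by (cases s) auto
qed

lemma length_conv_count_list:
  "length xs = count_list xs PX + count_list xs NX + count_list xs PY + count_list xs NY
     + count_list xs PZ + count_list xs NZ"
proof (induction xs)
  case (Cons s xs)
  then show ?case by (cases s) auto
qed simp

lemma less_4_cases: "(\<forall>i<4. P i) \<longleftrightarrow> P 0 \<and> P 1 \<and> P 2 \<and> P (3::nat)"
  by (simp add: eval_nat_numeral All_less_Suc conj_ac)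

lemma sum_less_4: "(\<Sum>i<4. f i) = f 0 + f 1 + f 2 + f (3::nat)"
  by (simp add: eval_nat_numeral)

lemma column_carrier: "column s \<in> carrier_vec 4"
  by (rule carrier_vecI) (cases s; simp add: column_def)

lemma column_nth:
  "column PX $ 0 = 1" "column PX $ 1 = 1" "column PX $ 2 = -1" "column PX $ 3 = -1"
  "column NX $ 0 = -1" "column NX $ 1 = -1" "column NX $ 2 = 1" "column NX $ 3 = 1"
  "column PY $ 0 = 1" "column PY $ 1 = -1" "column PY $ 2 = 1" "column PY $ 3 = -1"
  "column NY $ 0 = -1" "column NY $ 1 = 1" "column NY $ 2 = -1" "column NY $ 3 = 1"
  "column PZ $ 0 = 1" "column PZ $ 1 = -1" "column PZ $ 2 = -1" "column PZ $ 3 = 1"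
  "column NZ $ 0 = -1" "column NZ $ 1 = 1" "column NZ $ 2 = 1" "column NZ $ 3 = -1"
  by (simp_all add: column_def eval_nat_numeral)

lemma inj_column: "inj column"
proof (rule injI)
  fix s t assume "column s = column t"
  then have "\<forall>i<4. column s $ i = column t $ i" by simp
  then show "s = t"
    unfolding less_4_cases by (cases s; cases t) (simp_all only: column_nth, auto)
qed

text \<open>A sum of four signs is even, so the bound 1 forces it to be 0: two entries of each sign,
  which gives six columns. The proof checks all 16 sign patterns.\<close>

lemma range_column:
  "range column = {v \<in> carrier_vec 4. (\<forall>i<4. v $ i \<in> {1, -1}) \<and> \<bar>\<Sum>i<4. v $ i\<bar> \<le> 1}"
proof (intro equalityI subsetI)
  fix v assume "v \<in> range column"
  then obtain s where "v = column s" by blast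
  moreover have "(\<forall>i<4. column s $ i \<in> {1, -1}) \<and> \<bar>\<Sum>i<4. column s $ i\<bar> \<le> 1"
    unfolding less_4_cases sum_less_4 by (cases s) (simp_all add: column_nth del: One_nat_def)
  ultimately show "v \<in> {v \<in> carrier_vec 4. (\<forall>i<4. v $ i \<in> {1, -1}) \<and> \<bar>\<Sum>i<4. v $ i\<bar> \<le> 1}"
    using column_carrier[of s] by simp
next
  fix v :: "int vec"
  assume "v \<in> {v \<in> carrier_vec 4. (\<forall>i<4. v $ i \<in> {1, -1}) \<and> \<bar>\<Sum>i<4. v $ i\<bar> \<le> 1}"
  then have dim: "dim_vec v = 4" and entries: "\<forall>i<4. v $ i \<in> {1, -1}"
    and sum: "\<bar>\<Sum>i<4. v $ i\<bar> \<le> 1"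
    by simp_all
  have "\<exists>s\<in>{PX, NX, PY, NY, PZ, NZ}. \<forall>i<4. v $ i = column s $ i"
    using entries sum unfolding less_4_cases sum_less_4
    by (elim conjE insertE emptyE) (simp_all add: column_nth del: One_nat_def)
  then obtain s where "\<forall>i<4. v $ i = column s $ i" by blast
  then have "v = column s"
    using dim carrier_vecD[OF column_carrier[of s]] by (intro eq_vecI) simp_all
  then show "v \<in> range column" by blast
qed

text \<open>The triple \<open>(x, y, z)\<close> is the endpoint of the walk, and the row sums are
  the entries of \<open>x a + y b + z c\<close>.\<close>

lemma row_sum_count_list:
  fixes xs
  defines "x \<equiv> int (count_list xs PX) - int (count_list xs NX)"
    and "y \<equiv> int (count_list xs PY) - int (count_list xs NY)"
    and "z \<equiv> int (count_list xs PZ) - int (count_list xs NZ)"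
  shows "row_sum 0 xs = x + y + z" "row_sum 1 xs = x - y - z"
    "row_sum 2 xs = y - x - z" "row_sum 3 xs = z - x - y"
proof -
  have "row_sum 0 xs = x + y + z \<and> row_sum 1 xs = x - y - z \<and>
    row_sum 2 xs = y - x - z \<and> row_sum 3 xs = z - x - y"
    unfolding assms
  proof (induction xs)
    case (Cons s xs)
    then show ?case
      by (cases s) (simp_all add: row_sum_def column_nth del: One_nat_def)
  qed (simp add: row_sum_def)
  then show "row_sum 0 xs = x + y + z" "row_sum 1 xs = x - y - z"
    "row_sum 2 xs = y - x - z" "row_sum 3 xs = z - x - y" by blast+
qed

lemma even_row_sum_iff:
  assumes "i < 4"
  shows "even (row_sum i xs) \<longleftrightarrow> even (length xs)"
proof (induction xs)
  case (Cons s xs)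
  have "column s $ i \<in> {1, -1}" using assms range_column by blast
  then have "odd (column s $ i)" by auto
  then show ?case using Cons by (simp add: row_sum_def)
qed (simp add: row_sum_def)

section \<open>Matrices as lattice walks\<close>

definition balanced_walks :: "nat \<Rightarrow> step list set" where
  "balanced_walks n = {xs. length xs = n \<and> (\<forall>i<4. \<bar>row_sum i xs\<bar> \<le> 1)}"

text \<open>Reading a matrix column by column is a bijection: \<open>range_column\<close> absorbs
  the column condition, so only the condition on row sums remains for walks.\<close>

lemma alpha_4_eq_card_balanced_walks: "alpha 4 n = card (balanced_walks n)"
proof -
  let ?F = "\<lambda>xs. mat_of_cols 4 (map column xs)"
  have carrier: "set (map column xs) \<subseteq> carrier_vec 4" for xs
    using column_carrier by auto
  have "inj ?F"
    by (rule injI) (metis carrier cols_mat_of_cols inj_column inj_map_eq_map)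
  moreover have "?F ` balanced_walks n = balanced_mats 4 n"
  proof -
    have rows: "(\<Sum>j<length xs. ?F xs $$ (i, j)) = row_sum i xs" if "i < 4" for i xs
      using that by (simp add: mat_of_cols_index row_sum_def sum_list_sum_nth lessThan_atLeast0)
    show ?thesis
    proof (intro equalityI subsetI)
      fix M assume "M \<in> ?F ` balanced_walks n"
      then obtain xs where xs: "xs \<in> balanced_walks n" and M: "M = ?F xs" by blast
      have entry: "M $$ (i, j) = column (xs ! j) $ i" if "i < 4" "j < n" for i j
        using that xs by (simp add: M mat_of_cols_index balanced_walks_def)
      have col: "(\<forall>i<4. column s $ i \<in> {1, -1}) \<and> \<bar>\<Sum>i<4. column s $ i\<bar> \<le> 1" for s
        using range_column by blast
      have "\<forall>i<4. \<bar>\<Sum>j<n. M $$ (i, j)\<bar> \<le> 1"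
      proof (intro allI impI)
        fix i :: nat assume "i < 4"
        then show "\<bar>\<Sum>j<n. M $$ (i, j)\<bar> \<le> 1"
          using xs rows[of i xs] by (simp add: M balanced_walks_def)
      qed
      moreover have "M \<in> carrier_mat 4 n"
        using xs mat_of_cols_carrier(1)[of 4 "map column xs"] by (simp add: M balanced_walks_def)
      ultimately show "M \<in> balanced_mats 4 n"
        using col by (simp add: balanced_mats_def entry)
    next
      fix M assume M: "M \<in> balanced_mats 4 n"
      then have dim: "dim_row M = 4" "dim_col M = n" by (auto simp: balanced_mats_def)
      have "set (cols M) \<subseteq> range column"
      proof
        fix v assume "v \<in> set (cols M)"
        then obtain j where "j < n" "v = col M j" by (auto simp: cols_def dim)
        then show "v \<in> range column"
          using M dim unfolding range_column balanced_mats_def by auto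
      qed
      then obtain xs where xs: "cols M = map column xs"
        using ex_map_conv[of "cols M" column] by blast
      then have F: "M = ?F xs" using mat_of_cols_cols[of M] dim by simp
      have len: "length xs = n" using arg_cong[OF xs, of length] dim by simp
      have "xs \<in> balanced_walks n"
        using M len rows[of _ xs, folded F]
        unfolding balanced_walks_def balanced_mats_def mem_Collect_eq by simp
      then show "M \<in> ?F ` balanced_walks n" using F by blast
    qed
  qed
  ultimately show ?thesis
    unfolding alpha_def by (metis card_image inj_on_subset subset_UNIV)
qed

section \<open>Even and odd widths\<close>

lemma balanced_walks_even:
  "balanced_walks (2 * k) = {xs. length xs = 2 * k \<and> closed_walk xs}"
proof -
  have "(\<forall>i<4. \<bar>row_sum i xs\<bar> \<le> 1) \<longleftrightarrow> closed_walk xs" if "length xs = 2 * k" for xs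
  proof
    assume rows: "\<forall>i<4. \<bar>row_sum i xs\<bar> \<le> 1"
    have "row_sum i xs = 0" if "i < 4" for i
    proof -
      have "even (row_sum i xs)" using even_row_sum_iff[OF that] \<open>length xs = 2 * k\<close> by simp
      moreover have "row_sum i xs \<in> {-1, 0, 1}" using rows that by force
      ultimately show ?thesis by auto
    qed
    then have "\<forall>i<4. row_sum i xs = 0" by blast
    \<comment> \<open>Adding row sum 0 to each of the row sums 1, 2, 3 gives twice one coordinate of
      the endpoint.\<close>
    then show "closed_walk xs"
      unfolding less_4_cases row_sum_count_list closed_walk_def by linarith
  next
    assume "closed_walk xs"
    then show "\<forall>i<4. \<bar>row_sum i xs\<bar> \<le> 1"
      unfolding less_4_cases row_sum_count_list closed_walk_def by simp
  qed
  then show ?thesis by (auto simp: balanced_walks_def)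
qed

text \<open>Deleting the first step is a bijection from closed walks: a balanced walk of odd length
  ends next to the origin, so exactly one step closes it.\<close>

lemma card_balanced_walks_odd:
  "card (balanced_walks (2 * k + 1)) = card (balanced_walks (2 * k + 2))"
proof -
  let ?C = "balanced_walks (2 * k + 2)"
  have C: "?C = {xs. length xs = 2 * k + 2 \<and> closed_walk xs}"
    using balanced_walks_even[of "Suc k"] by simp
  have "inj_on tl ?C"
  proof (rule inj_onI)
    fix us vs assume us: "us \<in> ?C" and vs: "vs \<in> ?C" and tl: "tl us = tl vs"
    have "us \<noteq> []" "vs \<noteq> []" using us vs unfolding C by auto
    then have eq: "us = hd us # tl us" "vs = hd vs # tl us" using tl by (metis list.collapse)+
    \<comment> \<open>The counts in \<open>ws\<close> determine which step is missing.\<close>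
    have "s = t" if "closed_walk (s # ws)" "closed_walk (t # ws)" for s t ws
      using that by (cases s; cases t) (auto simp: closed_walk_def)
    moreover have "closed_walk (hd us # tl us)" "closed_walk (hd vs # tl us)"
      using us vs eq unfolding C mem_Collect_eq by metis+
    ultimately show "us = vs" using eq by metis
  qed
  moreover have "tl ` ?C = balanced_walks (2 * k + 1)"
  proof (intro equalityI subsetI)
    fix ws assume "ws \<in> tl ` ?C"
    then obtain s where len: "length ws = 2 * k + 1" and closed: "closed_walk (s # ws)"
      unfolding C by (auto simp: length_Suc_conv)
    \<comment> \<open>The row sums of \<open>ws\<close> are the entries of the negated column of
      \<open>s\<close>, hence signs.\<close>
    then have "\<forall>i<4. \<bar>row_sum i ws\<bar> \<le> 1"
      unfolding less_4_cases row_sum_count_list closed_walk_def by (cases s) auto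
    with len show "ws \<in> balanced_walks (2 * k + 1)" by (simp add: balanced_walks_def)
  next
    fix ws assume ws: "ws \<in> balanced_walks (2 * k + 1)"
    then have len: "length ws = 2 * k + 1" and "\<forall>i<4. \<bar>row_sum i ws\<bar> \<le> 1"
      by (auto simp: balanced_walks_def)
    define x y z where "x = int (count_list ws PX) - int (count_list ws NX)"
      and "y = int (count_list ws PY) - int (count_list ws NY)"
      and "z = int (count_list ws PZ) - int (count_list ws NZ)"
    have rows: "\<bar>x + y + z\<bar> \<le> 1" "\<bar>x - y - z\<bar> \<le> 1" "\<bar>y - x - z\<bar> \<le> 1" "\<bar>z - x - y\<bar> \<le> 1"
      using \<open>\<forall>i<4. \<bar>row_sum i ws\<bar> \<le> 1\<close>
      unfolding less_4_cases row_sum_count_list x_def y_def z_def by auto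
    have "odd (x + y + z)"
      using even_row_sum_iff[of 0 ws] len unfolding row_sum_count_list x_def y_def z_def by simp
    moreover have "\<bar>x\<bar> \<le> 1" "\<bar>y\<bar> \<le> 1" "\<bar>z\<bar> \<le> 1"
      using rows by linarith+
    then have "x \<in> {-1, 0, 1}" "y \<in> {-1, 0, 1}" "z \<in> {-1, 0, 1}"
      by auto
    \<comment> \<open>An odd sum means one or three nonzero coordinates; three would make some row
      sum 3 or -3.\<close>
    ultimately have "(x, y, z) \<in> {(1, 0, 0), (-1, 0, 0), (0, 1, 0), (0, -1, 0), (0, 0, 1), (0, 0, -1)}"
      using rows by (elim insertE emptyE) simp_all
    then have "closed_walk (NX # ws) \<or> closed_walk (PX # ws) \<or> closed_walk (NY # ws) \<or>
        closed_walk (PY # ws) \<or> closed_walk (NZ # ws) \<or> closed_walk (PZ # ws)"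
      unfolding x_def y_def z_def closed_walk_def by (elim insertE emptyE) simp_all
    then obtain s where "closed_walk (s # ws)" by blast
    then have "s # ws \<in> ?C" using len unfolding C by simp
    then show "ws \<in> tl ` ?C" by force
  qed
  ultimately show ?thesis by (metis card_image)
qed

section \<open>Counting closed walks\<close>

lemma fact_multinomial_square:
  fixes p q r :: nat
  defines "k \<equiv> p + q + r"
  shows "fact (2 * k) div (fact p * fact q * fact r)\<^sup>2 =
    (2 * k choose k) * (k choose (p + q))\<^sup>2 * (p + q choose p)\<^sup>2"
proof -
  \<comment> \<open>The multinomial coefficient of \<open>k\<close> is split at
    \<open>p + q\<close>, which later becomes the summation index \<open>i\<close>.\<close>
  have "fact (2 * k) = (2 * k choose k) * (fact k)\<^sup>2"
    using binomial_fact_lemma[of k "2 * k"] by (simp add: power2_eq_square ac_simps)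
  moreover have "fact k = (k choose (p + q)) * fact (p + q) * (fact r :: nat)"
    using binomial_fact_lemma[of "p + q" k] by (simp add: k_def ac_simps)
  moreover have "fact (p + q) = (p + q choose p) * fact p * (fact q :: nat)"
    using binomial_fact_lemma[of p "p + q"] by (simp add: ac_simps)
  ultimately have "fact (2 * k) = ((2 * k choose k) * (k choose (p + q))\<^sup>2 * (p + q choose p)\<^sup>2) *
      (fact p * fact q * fact r :: nat)\<^sup>2"
    by (simp only: power_mult_distrib ac_simps)
  then show ?thesis by simp
qed

text \<open>A multiset encoding turns the closed walks with \<open>p\<close>, \<open>q\<close>,
  \<open>r\<close> positive steps along the axes into the permutations of one multiset.\<close>

definition closed_content :: "nat \<Rightarrow> nat \<Rightarrow> nat \<Rightarrow> step multiset" where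
  "closed_content p q r = replicate_mset p PX + replicate_mset p NX +
     replicate_mset q PY + replicate_mset q NY + replicate_mset r PZ + replicate_mset r NZ"

lemma card_permutations_closed_content:
  "card (permutations_of_multiset (closed_content p q r)) =
     (2 * (p + q + r) choose (p + q + r)) * (p + q + r choose (p + q))\<^sup>2 * (p + q choose p)\<^sup>2"
proof -
  let ?A = "closed_content p q r"
  have fin: "finite (UNIV :: step set)" by (simp add: UNIV_step)
  \<comment> \<open>Steps that do not occur contribute the factor \<open>fact 0 = 1\<close>, so the
    product may run over all six.\<close>
  have "(\<Prod>s\<in>set_mset ?A. fact (count ?A s) :: nat) = (\<Prod>s\<in>UNIV. fact (count ?A s))"
    by (rule prod.mono_neutral_left) (auto simp: fin not_in_iff)
  also have "\<dots> = (fact p * fact q * fact r)\<^sup>2"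
    unfolding UNIV_step by (simp add: closed_content_def power2_eq_square)
  finally have factors:
    "(\<Prod>s\<in>set_mset ?A. fact (count ?A s)) = (fact p * fact q * fact r :: nat)\<^sup>2" .
  have "size ?A = 2 * (p + q + r)" by (simp add: closed_content_def)
  then show ?thesis
    unfolding card_permutations_of_multiset factors by (simp only: fact_multinomial_square)
qed

lemma mset_eq_closed_content_iff:
  "mset xs = closed_content p q r \<longleftrightarrow> closed_walk xs \<and>
     count_list xs PX = p \<and> count_list xs PY = q \<and> count_list xs PZ = r"
proof -
  have "mset xs = closed_content p q r \<longleftrightarrow>
      (\<forall>s\<in>UNIV. count_list xs s = count (closed_content p q r) s)"
    by (simp add: multiset_eq_iff count_mset)
  then show ?thesis
    unfolding UNIV_step by (auto simp: closed_content_def closed_walk_def)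
qed

text \<open>Walks are sorted by content. For fixed \<open>i = p + q\<close>, the squares of
  \<open>i choose p\<close> add up to \<open>2 * i choose i\<close>, which removes the sum over
  \<open>p\<close>.\<close>

lemma card_closed_walks:
  "card {xs. length xs = 2 * k \<and> closed_walk xs} =
     (2 * k choose k) * (\<Sum>i = 0..k. (k choose i)\<^sup>2 * (2 * i choose i))"
proof -
  let ?W = "\<lambda>(i, p). permutations_of_multiset (closed_content p (i - p) (k - i))"
  \<comment> \<open>The bounds \<open>p \<le> i \<le> k\<close> keep both natural subtractions
    exact, so a content determines its pair and the classes are disjoint.\<close>
  let ?I = "Sigma {0..k} (\<lambda>i. {..i})"
  have "{xs. length xs = 2 * k \<and> closed_walk xs} = \<Union> (?W ` ?I)"
  proof (intro equalityI subsetI)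
    fix xs assume "xs \<in> {xs. length xs = 2 * k \<and> closed_walk xs}"
    then have xs: "length xs = 2 * k" "closed_walk xs" by auto
    let ?p = "count_list xs PX" and ?q = "count_list xs PY"
    have k: "k = ?p + ?q + count_list xs PZ"
      using xs unfolding length_conv_count_list closed_walk_def by simp
    have "xs \<in> ?W (?p + ?q, ?p)"
      using xs k by (auto simp: permutations_of_multiset_def mset_eq_closed_content_iff)
    moreover have "(?p + ?q, ?p) \<in> ?I" using k by auto
    ultimately show "xs \<in> \<Union> (?W ` ?I)" by blast
  next
    fix xs assume "xs \<in> \<Union> (?W ` ?I)"
    then show "xs \<in> {xs. length xs = 2 * k \<and> closed_walk xs}"
      by (auto simp: permutations_of_multiset_def mset_eq_closed_content_iff
          length_conv_count_list[of xs] closed_walk_def)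
  qed
  also have "card \<dots> = (\<Sum>x\<in>?I. card (?W x))"
  proof (rule card_UN_disjoint)
    show "\<forall>x\<in>?I. \<forall>y\<in>?I. x \<noteq> y \<longrightarrow> ?W x \<inter> ?W y = {}"
      by (auto simp: permutations_of_multiset_def mset_eq_closed_content_iff)
  qed auto
  also have "\<dots> = (\<Sum>i = 0..k. \<Sum>p\<le>i. card (?W (i, p)))"
    by (simp add: sum.Sigma split_def)
  also have "\<dots> = (\<Sum>i = 0..k. \<Sum>p\<le>i. (2 * k choose k) * (k choose i)\<^sup>2 * (i choose p)\<^sup>2)"
  proof (intro sum.cong refl)
    fix i p assume "i \<in> {0..k}" "p \<in> {..i}"
    then show "card (?W (i, p)) = (2 * k choose k) * (k choose i)\<^sup>2 * (i choose p)\<^sup>2"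
      using card_permutations_closed_content[of p "i - p" "k - i"] by simp
  qed
  also have "\<dots> = (2 * k choose k) * (\<Sum>i = 0..k. (k choose i)\<^sup>2 * (2 * i choose i))"
    by (simp add: sum_distrib_left mult.assoc flip: choose_square_sum)
  finally show ?thesis .
qed

theorem theorem2:
  fixes n :: nat
  assumes "n > 0"
  shows "alpha 4 n =
    (2 * nat \<lceil>real n / 2\<rceil> choose nat \<lceil>real n / 2\<rceil>) *
    (\<Sum>i = 0..nat \<lceil>real n / 2\<rceil>. (nat \<lceil>real n / 2\<rceil> choose i)^2 * (2 * i choose i))"
proof -
  define k where "k = nat \<lceil>real n / 2\<rceil>"
  \<comment> \<open>Rounding \<open>n\<close> up to the even number \<open>2 * k\<close> does not
    change the count.\<close>
  have "card (balanced_walks n) = card (balanced_walks (2 * k))"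
  proof (cases "even n")
    case True
    then have "n = 2 * k" by (auto simp: k_def)
    then show ?thesis by simp
  next
    case False
    then obtain m where n: "n = 2 * m + 1" by (rule oddE)
    then have "\<lceil>real n / 2\<rceil> = int m + 1" by (intro ceiling_unique) (auto simp: field_simps)
    then have "k = m + 1" by (simp add: k_def)
    then show ?thesis using card_balanced_walks_odd[of m] n by simp
  qed
  then show ?thesis
    unfolding alpha_4_eq_card_balanced_walks balanced_walks_even card_closed_walks k_def .
qed

end
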